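(* Let $d\ge2$ and let $P=\{p_1,\ldots,p_d\}$, $Q=\{q_1,\ldots,q_d\}$ be posets. The following are equivalent: (i) $\Gamma(\mathcal{O}(P),-\mathcal{C}(Q))$ is $\mathbb{Q}$-factorial; (ii) $\Gamma(\mathcal{O}(P),-\mathcal{C}(Q))$ is smooth; (iii) there is a permutation $i_1,\ldots,i_d$ of $[d]$ such that the set of nonempty poset ideals of $P$ is either $\{\{p_{i_1}\},\{p_{i_1},p_{i_2}\},\ldots,\{p_{i_1},\ldots,p_{i_d}\}\}$ or $\{\{p_{i_1}\},\{p_{i_2}\},\{p_{i_1},p_{i_2}\},\{p_{i_1},p_{i_2},p_{i_3}\},\ldots,\{p_{i_1},\ldots,p_{i_d}\}\}$, and the set of nonempty antichains of $Q$ is either $\{\{q_{i_1}\},\ldots,\{q_{i_d}\}\}$ or $\{\{q_{i_1}\},\ldots,\{q_{i_d}\},\{q_{i_1},q_{i_2}\}\}$.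
   Context: For $S\subset P$ (resp. $Q$), $\rho(S)=\sum_{p_i\in S}\mathbf{e}_i$ (resp. $\sum_{q_i\in S}\mathbf{e}_i$). $\Gamma(\mathcal{O}(P),-\mathcal{C}(Q))$ is the convex hull in $\mathbb{R}^d$ of $\{\rho(I):I\text{ poset ideal of }P\}\cup\{-\rho(A):A\text{ antichain of }Q\}$ (including $\emptyset$); it is a $d$-dimensional Fano polytope. A Fano polytope is $\mathbb{Q}$-factorial if it is simplicial, and smooth if the vertices of each facet form a $\mathbb{Z}$-basis of $\mathbb{Z}^d$. *)

theory Defs
  imports "HOL-Analysis.Analysis"
begin

text \<open>
  A finite poset on \<open>{p\<^sub>1, \<dots>, p\<^sub>d}\<close> is given by a carrier \<open>P\<close>, a (non-strict) order relation
  \<open>r\<close> with \<^term>\<open>partial_order_on P r\<close> (where \<open>(x, y) \<in> r\<close> means \<open>x \<le> y\<close>), and a bijective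
  labelling \<open>p\<close> of the elements by the coordinates of \<open>\<real>\<^sup>d\<close>.
\<close>

definition poset_ideal :: "'a set \<Rightarrow> ('a \<times> 'a) set \<Rightarrow> 'a set \<Rightarrow> bool" where
  "poset_ideal P r I \<longleftrightarrow> I \<subseteq> P \<and> (\<forall>x\<in>I. \<forall>y\<in>P. (y, x) \<in> r \<longrightarrow> y \<in> I)"

definition antichain :: "'a set \<Rightarrow> ('a \<times> 'a) set \<Rightarrow> 'a set \<Rightarrow> bool" where
  "antichain P r A \<longleftrightarrow> A \<subseteq> P \<and> (\<forall>x\<in>A. \<forall>y\<in>A. x \<noteq> y \<longrightarrow> (x, y) \<notin> r \<and> (y, x) \<notin> r)"

definition rho :: "('n \<Rightarrow> 'a) \<Rightarrow> 'a set \<Rightarrow> real ^ 'n::finite" where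
  "rho p S = (\<Sum>i | p i \<in> S. axis i 1)"

definition Gamma_OC ::
  "'a set \<Rightarrow> ('a \<times> 'a) set \<Rightarrow> ('n::finite \<Rightarrow> 'a) \<Rightarrow> 'b set \<Rightarrow> ('b \<times> 'b) set \<Rightarrow> ('n \<Rightarrow> 'b) \<Rightarrow> (real ^ 'n) set"
  where
  "Gamma_OC P r p Q s q =
     convex hull ({rho p I | I. poset_ideal P r I} \<union> {- rho q A | A. antichain Q s A})"

definition int_lattice :: "(real ^ 'n::finite) set" where
  "int_lattice = {v. \<forall>i. v $ i \<in> \<int>}"

global_interpretation int_module: module "\<lambda>(c::int) (v :: real ^ 'n::finite). of_int c *\<^sub>R v"
  by unfold_locales (simp_all add: scaleR_add_right scaleR_add_left)

definition int_lattice_basis :: "(real ^ 'n::finite) set \<Rightarrow> bool" where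
  "int_lattice_basis B \<longleftrightarrow> int_module.independent B \<and> int_module.span B = int_lattice"

definition polytope_vertices :: "'a::real_vector set \<Rightarrow> 'a set" where
  "polytope_vertices S = {v. v extreme_point_of S}"

text \<open>A Fano polytope is a full-dimensional lattice polytope whose only interior lattice point is
  the origin; full-dimensionality is implied by the interior containing the origin.\<close>

definition fano_polytope :: "(real ^ 'n::finite) set \<Rightarrow> bool" where
  "fano_polytope S \<longleftrightarrow>
     polytope S \<and> polytope_vertices S \<subseteq> int_lattice \<and> interior S \<inter> int_lattice = {0}"

definition simplicial_polytope :: "'a::euclidean_space set \<Rightarrow> bool" where
  "simplicial_polytope S \<longleftrightarrow> polytope S \<and> (\<forall>F. F facet_of S \<longrightarrow> (\<exists>n. n simplex F))"

definition Q_factorial_fano :: "(real ^ 'n::finite) set \<Rightarrow> bool" where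
  "Q_factorial_fano S \<longleftrightarrow> fano_polytope S \<and> simplicial_polytope S"

definition smooth_fano :: "(real ^ 'n::finite) set \<Rightarrow> bool" where
  "smooth_fano S \<longleftrightarrow>
     fano_polytope S \<and> (\<forall>F. F facet_of S \<longrightarrow> int_lattice_basis (polytope_vertices F))"

end

theory Submission
  imports Defs
begin

text \<open>
  Every polytope \<open>\<Gamma>(O(P), -C(Q))\<close> is Fano with vertex set \<open>{\<rho>(I)} \<union> {-\<rho>(A)}\<close> (\<open>I\<close>, \<open>A\<close> nonempty).
  If four vertices on a common supporting hyperplane \<open>f = 1\<close> satisfy \<open>v\<^sub>1 + v\<^sub>2 = v\<^sub>3 + v\<^sub>4\<close>
  nontrivially, some facet is neither a simplex nor unimodular.

  Two incomparable ideals \<open>I\<close>, \<open>J\<close> that meet in \<open>a\<close> give such a relation with \<open>I \<union> J\<close> and \<open>I \<inter> J\<close>, for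
  \<open>f = x\<^sub>a\<close>. Hence, along a linear extension \<open>i\<close> of \<open>P\<close>, every nonempty ideal is an initial segment or
  \<open>{p (i 2)}\<close>. Next, let \<open>x\<close>, \<open>y\<close> be incomparable in \<open>Q\<close>. If \<open>K\<close> and \<open>K \<union> {x}\<close> are ideals of \<open>P\<close>, then
  \<open>\<rho>(K \<union> {x}) - \<rho>({x, y}) = \<rho>(K) - \<rho>({y})\<close>, and a suitable \<open>f\<close> supports this relation unless
  \<open>{x, y} = {i 1, i 2}\<close>.

  Conversely, let the ideals and antichains be of the stated form and let \<open>f = 1\<close> support a facet.
  For \<open>k \<ge> 3\<close> at most one of \<open>\<rho>(i 1, \<dots>, i k)\<close> and \<open>-e\<^bsub>i k\<^esub>\<close> lies on it, since their sum
  \<open>\<rho>(i 1, \<dots>, i (k-1))\<close> is again a vertex. The remaining vertices form part of a hexagon in a coordinate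
  plane, of which a facet contains at most two points. So the vertices of the facet lie in a
  unimodular triangular system of \<open>d\<close> vectors, and a dimension count makes the two sets equal.
\<close>

section \<open>Indicator vectors, the integer lattice and extreme points\<close>

lemma rho_nth [simp]: "rho p S $ j = of_bool (p j \<in> S)"
  by (simp add: rho_def axis_def if_distrib [of "\<lambda>x. x $ j"] sum.delta' cong: if_cong)

lemma rho_empty [simp]: "rho p {} = 0"
  by (simp add: vec_eq_iff)

lemma rho_in_int_lattice: "rho p S \<in> int_lattice"
  by (simp add: int_lattice_def)

lemma rho_singleton: "inj p \<Longrightarrow> rho p {p j} = axis j 1"
  by (auto simp: vec_eq_iff axis_def inj_eq)

lemma rho_image: "inj p \<Longrightarrow> rho p (p ` J) = (\<Sum>j\<in>J. axis j 1)"
  by (simp add: rho_def inj_image_mem_iff)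

lemma subspace_int_lattice: "int_module.subspace int_lattice"
  by (rule int_module.subspaceI) (auto simp: int_lattice_def)

lemma int_lattice_subset_span:
  fixes B :: "(real ^ 'n::finite) set"
  assumes "\<And>j. axis j 1 \<in> int_module.span B"
  shows "int_lattice \<subseteq> int_module.span B"
proof
  fix v :: "real ^ 'n" assume v: "v \<in> int_lattice"
  have "v = (\<Sum>j\<in>UNIV. of_int \<lfloor>v $ j\<rfloor> *\<^sub>R axis j 1)"
    using v by (simp add: vec_eq_iff int_lattice_def axis_def if_distrib [of "\<lambda>x. _ * x"] cong: if_cong)
  moreover have "(\<Sum>j\<in>UNIV. of_int \<lfloor>v $ j\<rfloor> *\<^sub>R axis j 1) \<in> int_module.span B"
    by (intro int_module.span_sum int_module.span_scale assms)
  ultimately show "v \<in> int_module.span B"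
    by (rule ssubst)
qed

lemma int_span_subset_span: "int_module.span B \<subseteq> span B"
  by (rule int_module.span_minimal)
     (auto simp: span_superset span_zero span_add span_scale intro!: int_module.subspaceI)

text \<open>Generating the axis vectors makes \<open>B\<close> span the real space; with at most
  \<open>CARD('n)\<close> members it is then independent over the reals, hence over the
  integers.\<close>

lemma int_lattice_basisI:
  fixes B :: "(real ^ 'n::finite) set"
  assumes "finite B" "card B \<le> CARD('n)" "B \<subseteq> int_lattice"
    and ax: "\<And>j. axis j 1 \<in> int_module.span B"
  shows "int_lattice_basis B"
proof -
  have "b \<in> span B" if "b \<in> Basis" for b
    using that ax int_span_subset_span by (auto simp: Basis_vec_def)
  then have "span Basis \<subseteq> span B"
    by (intro span_minimal subsetI) auto
  then have "span B = UNIV"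
    by auto
  then have "independent B"
    by (intro card_le_dim_spanning [of B UNIV]) (use assms in auto)
  then have indep: "u v = 0"
    if "finite t" "t \<subseteq> B" "(\<Sum>v\<in>t. of_int (u v) *\<^sub>R v) = 0" "v \<in> t" for t u v
    using independentD [of B t "\<lambda>v. of_int (u v)" v] that by simp
  have "int_module.independent B"
    unfolding int_module.independent_explicit_module using indep by blast
  moreover have "int_module.span B = int_lattice"
    using int_lattice_subset_span [OF ax] assms(3) int_module.span_minimal [OF _ subspace_int_lattice]
    by blast
  ultimately show ?thesis
    by (simp add: int_lattice_basis_def)
qed

text \<open>The inequalities \<open>x\<^sub>a - x\<^sub>j \<le> 1\<close> make a \<open>0/1\<close> vector with \<open>a\<close> in its support extreme:
  they turn the equation \<open>x\<^sub>a = 1\<close> into \<open>x\<^sub>j \<ge> 0\<close> for all \<open>j\<close>.\<close>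

lemma extreme_point_signed_rho:
  fixes S :: "(real ^ 'n::finite) set"
  assumes bounds: "\<And>z j. z \<in> S \<Longrightarrow> \<bar>z $ j\<bar> \<le> 1"
    and diffs: "\<And>z a j. z \<in> S \<Longrightarrow> z $ a - z $ j \<le> 1"
    and c: "\<bar>c\<bar> = 1" and a: "p a \<in> I" and mem: "c *\<^sub>R rho p I \<in> S"
  shows "(c *\<^sub>R rho p I) extreme_point_of S"
proof -
  have cc: "c * c = 1"
    using c by (auto simp: abs_if split: if_splits)
  \<comment> \<open>Applied with \<open>w = 1\<close> on the support of \<open>I\<close> and, after
    a change of sign, with \<open>w = 0\<close> off it.\<close>
  have conv1: "x = w \<and> y = w" if "(1 - u) * x + u * y = w" "0 < u" "u < 1" "x \<le> w" "y \<le> w"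
    for u x y w :: real
  proof -
    have "(1 - u) * (w - x) + u * (w - y) = 0"
      using that(1) by (simp add: algebra_simps)
    moreover have "(1 - u) * (w - x) \<ge> 0" "u * (w - y) \<ge> 0"
      using that by auto
    ultimately have "(1 - u) * (w - x) = 0" "u * (w - y) = 0" by linarith+
    then show ?thesis using that by auto
  qed
  have "x = y" if "x \<in> S" "y \<in> S" "0 < u" "u < 1" and eq: "c *\<^sub>R rho p I = (1 - u) *\<^sub>R x + u *\<^sub>R y" for x y u
  proof -
    have comp: "(1 - u) * (c * x $ j) + u * (c * y $ j) = of_bool (p j \<in> I)" for j
    proof -
      have "c * (c * of_bool (p j \<in> I)) = c * ((1 - u) * x $ j + u * y $ j)"
        using arg_cong [OF eq, of "\<lambda>v. c * v $ j"] by simp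
      then show ?thesis
        by (metis (no_types, lifting) cc distrib_left mult.assoc mult.left_commute mult_1)
    qed
    have le1: "c * z $ j \<le> 1" if "z \<in> S" for z j
      using bounds [OF that, of j] c by (auto simp: abs_if split: if_splits)
    have sup: "c * x $ j = 1 \<and> c * y $ j = 1" if "p j \<in> I" for j
      using conv1 [OF comp [of j, unfolded of_bool_def, simplified that, simplified]]
        le1 \<open>x \<in> S\<close> \<open>y \<in> S\<close> \<open>0 < u\<close> \<open>u < 1\<close> by simp
    \<comment> \<open>\<open>diffs\<close> is used at \<open>(a, j)\<close> for \<open>c = 1\<close>
      and at \<open>(j, a)\<close> for \<open>c = -1\<close>.\<close>
    have ge0: "c * z $ j \<ge> 0" if "z \<in> S" "c * z $ a = 1" for z j
      using diffs [OF that(1), of a j] diffs [OF that(1), of j a] that(2) c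
      by (auto simp: abs_if split: if_splits)
    have "c * x $ j = c * y $ j" for j
    proof (cases "p j \<in> I")
      case False
      then have "(1 - u) * (- (c * x $ j)) + u * (- (c * y $ j)) = 0"
        using comp [of j] by simp
      from conv1 [OF this] show ?thesis
        using ge0 sup [OF a] \<open>x \<in> S\<close> \<open>y \<in> S\<close> \<open>0 < u\<close> \<open>u < 1\<close> by auto
    qed (use sup in simp)
    then show ?thesis
      using c by (force simp: vec_eq_iff)
  qed
  then have "c *\<^sub>R rho p I \<notin> open_segment x y" if "x \<in> S" "y \<in> S" for x y
    using that by (metis in_segment(2))
  then show ?thesis
    using mem unfolding extreme_point_of_def by blast
qed

section \<open>The Fano property and the vertices\<close>

locale labelled_posets =
  fixes P :: "'a set" and r :: "('a \<times> 'a) set" and p :: "'n::finite \<Rightarrow> 'a"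
    and Q :: "'b set" and s :: "('b \<times> 'b) set" and q :: "'n \<Rightarrow> 'b"
  assumes card2: "CARD('n) \<ge> 2"
    and po_P: "partial_order_on P r" and bij_p: "bij_betw p UNIV P"
    and po_Q: "partial_order_on Q s" and bij_q: "bij_betw q UNIV Q"
begin

definition \<Gamma> :: "(real ^ 'n) set" where "\<Gamma> = Gamma_OC P r p Q s q"

text \<open>Empty sets are left out: they contribute only the origin, an interior point, whereas all
  other points turn out to be vertices (\<open>extreme_gens\<close>).\<close>

definition gens :: "(real ^ 'n) set" where
  "gens = {rho p I | I. poset_ideal P r I \<and> I \<noteq> {}} \<union> {- rho q A | A. antichain Q s A \<and> A \<noteq> {}}"

lemma inj_p: "inj p" and inj_q: "inj q" and P_eq: "P = range p" and Q_eq: "Q = range q"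
  using bij_p bij_q by (auto simp: bij_betw_def)

lemma \<Gamma>_eq: "\<Gamma> = convex hull (insert 0 gens)"
proof -
  have "{rho p I | I. poset_ideal P r I} \<union> {- rho q A | A. antichain Q s A} = insert 0 gens"
    (is "?L = _")
  proof
    show "?L \<subseteq> insert 0 gens"
      unfolding gens_def by auto
    have "poset_ideal P r {}"
      by (simp add: poset_ideal_def)
    then have "rho p {} \<in> ?L" by blast
    then show "insert 0 gens \<subseteq> ?L"
      unfolding gens_def by auto
  qed
  then show ?thesis
    by (simp add: \<Gamma>_def Gamma_OC_def)
qed

lemma gens_rhoI: "poset_ideal P r I \<Longrightarrow> I \<noteq> {} \<Longrightarrow> rho p I \<in> gens"
  and gens_minus_rhoI: "antichain Q s A \<Longrightarrow> A \<noteq> {} \<Longrightarrow> - rho q A \<in> gens"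
  by (auto simp: gens_def)

lemma finite_gens: "finite gens"
proof -
  have "gens \<subseteq> rho p ` Pow P \<union> (\<lambda>A. - rho q A) ` Pow Q"
    by (auto simp: gens_def poset_ideal_def antichain_def)
  then show ?thesis
    by (rule finite_subset) (simp add: P_eq Q_eq)
qed

lemma polytope_\<Gamma>: "polytope \<Gamma>"
  using finite_gens by (auto simp: polytope_def \<Gamma>_eq)

lemma gens_subset_\<Gamma>: "gens \<subseteq> \<Gamma>" and zero_in_\<Gamma>: "0 \<in> \<Gamma>"
  using hull_subset [of "insert 0 gens" convex] by (auto simp: \<Gamma>_eq)

lemma gens_subset_int_lattice: "gens \<subseteq> int_lattice"
  by (auto simp: gens_def rho_in_int_lattice int_module.subspace_neg [OF subspace_int_lattice])

lemma \<Gamma>_inner_le: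
  assumes "\<And>v. v \<in> gens \<Longrightarrow> f \<bullet> v \<le> b" "b \<ge> 0" "x \<in> \<Gamma>"
  shows "f \<bullet> x \<le> b"
proof -
  have "\<Gamma> \<subseteq> {x. f \<bullet> x \<le> b}"
    unfolding \<Gamma>_eq by (rule hull_minimal) (use assms in \<open>auto simp: convex_halfspace_le\<close>)
  then show ?thesis
    using assms by blast
qed

text \<open>Each generator has its coordinates all in {0, 1} or all in {-1, 0}.\<close>

lemma \<Gamma>_diff_le:
  assumes "x \<in> \<Gamma>"
  shows "x $ a - x $ j \<le> 1"
proof -
  have "(axis a 1 - axis j 1) \<bullet> x \<le> 1"
    by (rule \<Gamma>_inner_le) (use assms in \<open>auto simp: gens_def inner_axis' inner_diff_left of_bool_def split: if_splits\<close>)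
  then show ?thesis
    by (simp add: inner_axis' inner_diff_left)
qed

lemma \<Gamma>_nth_le:
  assumes "x \<in> \<Gamma>"
  shows "\<bar>x $ j\<bar> \<le> 1"
proof -
  have "axis j 1 \<bullet> x \<le> 1"
    by (rule \<Gamma>_inner_le) (use assms in \<open>auto simp: gens_def inner_axis' of_bool_def split: if_splits\<close>)
  moreover have "- axis j 1 \<bullet> x \<le> 1"
    by (rule \<Gamma>_inner_le) (use assms in \<open>auto simp: gens_def inner_axis' of_bool_def split: if_splits\<close>)
  ultimately show ?thesis
    by (simp add: inner_axis' abs_le_iff)
qed

lemma nonempty_ideal:
  assumes "poset_ideal P r I" "I \<noteq> {}"
  obtains a where "p a \<in> I"
proof -
  obtain x where "x \<in> I" using assms(2) by blast
  moreover from this have "x \<in> range p"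
    using assms(1) by (auto simp: poset_ideal_def P_eq)
  ultimately show thesis using that by blast
qed

lemma nonempty_antichain:
  assumes "antichain Q s A" "A \<noteq> {}"
  obtains a where "q a \<in> A"
proof -
  obtain x where "x \<in> A" using assms(2) by blast
  moreover from this have "x \<in> range q"
    using assms(1) by (auto simp: antichain_def Q_eq)
  ultimately show thesis using that by blast
qed

lemma extreme_gens:
  assumes "v \<in> gens"
  shows "v extreme_point_of \<Gamma>"
proof -
  have v: "v \<in> \<Gamma>"
    using assms gens_subset_\<Gamma> by blast
  consider I where "v = rho p I" "poset_ideal P r I" "I \<noteq> {}"
    | A where "v = - rho q A" "antichain Q s A" "A \<noteq> {}"
    using assms unfolding gens_def by blast
  then show ?thesis
  proof cases
    case 1
    obtain a where a: "p a \<in> I"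
      using nonempty_ideal [OF 1(2,3)] .
    have "(1 *\<^sub>R rho p I) extreme_point_of \<Gamma>"
      by (rule extreme_point_signed_rho [where p = p and S = \<Gamma>, OF \<Gamma>_nth_le \<Gamma>_diff_le _ a]) (use v 1(1) in auto)
    then show ?thesis
      using 1(1) by simp
  next
    case 2
    obtain a where a: "q a \<in> A"
      using nonempty_antichain [OF 2(2,3)] .
    have "((-1) *\<^sub>R rho q A) extreme_point_of \<Gamma>"
      by (rule extreme_point_signed_rho [where p = q and S = \<Gamma>, OF \<Gamma>_nth_le \<Gamma>_diff_le _ a]) (use v 2(1) in auto)
    then show ?thesis
      using 2(1) by simp
  qed
qed

lemma extreme_point_\<Gamma>_cases: "v extreme_point_of \<Gamma> \<Longrightarrow> v = 0 \<or> v \<in> gens"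
  unfolding \<Gamma>_eq using extreme_point_of_convex_hull by blast

lemma singleton_antichain: "antichain Q s {q j}"
  by (simp add: antichain_def Q_eq)

text \<open>The all-ones vector \<open>rho p P\<close> and the vectors \<open>- axis j 1\<close> sum
  to zero and span the space, so they surround the origin.\<close>

lemma zero_in_interior_\<Gamma>: "0 \<in> interior \<Gamma>"
proof -
  define d where "d = real CARD('n)"
  \<comment> \<open>If \<open>\<bar>x $ j\<bar> \<le> e\<close> for all \<open>j\<close>, the
    weights \<open>e\<close> and \<open>e - x $ j\<close> are nonnegative and add up to at most
    \<open>e + 2 * d * e = 1\<close>.\<close>
  define e where "e = 1 / (1 + 2 * d)"
  have d: "d > 0" and e: "e > 0" "e * (1 + 2 * d) = 1"
    by (auto simp: d_def e_def add_pos_pos)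
  have conv: "convex \<Gamma>"
    by (simp add: \<Gamma>_eq)
  have one: "(1 :: real ^ 'n) \<in> \<Gamma>"
  proof -
    have "rho p P = 1"
      by (simp add: vec_eq_iff P_eq)
    then show ?thesis
      using gens_rhoI [of P] gens_subset_\<Gamma> by (auto simp: poset_ideal_def P_eq)
  qed
  have neg: "- axis j 1 \<in> \<Gamma>" for j
    using gens_minus_rhoI [OF singleton_antichain [of j]] gens_subset_\<Gamma>
    by (auto simp: rho_singleton [OF inj_q])
  have "ball 0 e \<subseteq> \<Gamma>"
  proof
    fix x :: "real ^ 'n" assume "x \<in> ball 0 e"
    then have x: "\<bar>x $ j\<bar> \<le> e" for j
      using component_le_norm_cart [of x j] by simp
    define S where "S = (\<Sum>j\<in>UNIV. e - x $ j)"
    have S0: "S \<ge> 0"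
      unfolding S_def by (rule sum_nonneg) (use x in \<open>auto simp: abs_le_iff\<close>)
    have "S \<le> (\<Sum>j\<in>(UNIV :: 'n set). 2 * e)"
      unfolding S_def
    proof (rule sum_mono)
      fix j show "e - x $ j \<le> 2 * e" using x [of j] by (auto simp: abs_le_iff)
    qed
    then have S1: "e + S \<le> 1"
      using e by (simp add: d_def algebra_simps)
    \<comment> \<open>\<open>None\<close> indexes the all-ones vector, \<open>Some j\<close> the
      vector \<open>- axis j 1\<close>. The missing weight \<open>1 - e - S\<close> goes to the
      origin.\<close>
    define w :: "'n option \<Rightarrow> real" where "w = case_option e (\<lambda>j. e - x $ j)"
    define y :: "'n option \<Rightarrow> real ^ 'n" where "y = case_option 1 (\<lambda>j. - axis j 1)"
    have "(\<Sum>k\<in>UNIV. w k *\<^sub>R y k) + (1 - e - S) *\<^sub>R 0 = e *\<^sub>R 1 + (\<Sum>j\<in>UNIV. (e - x $ j) *\<^sub>R - axis j 1)"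
      by (simp add: UNIV_option_conv sum.reindex w_def y_def sum_negf)
    also have "\<dots> = x"
      by (simp add: vec_eq_iff axis_def if_distrib [of "\<lambda>x. _ * x"] sum_negf cong: if_cong)
    finally have x_eq: "x = (\<Sum>k\<in>UNIV. w k *\<^sub>R y k)" by simp
    have "(\<Sum>k\<in>UNIV. w k) = e + S"
      by (simp add: UNIV_option_conv sum.reindex w_def S_def)
    moreover have "w k \<ge> 0" for k
      using x e by (cases k) (auto simp: w_def abs_le_iff)
    moreover have "y k \<in> \<Gamma>" for k
      using one neg by (cases k) (auto simp: y_def)
    ultimately have "(1 / (e + S)) *\<^sub>R x \<in> \<Gamma>"
      using e S0 convex_sum [of UNIV \<Gamma> "\<lambda>k. w k / (e + S)" y] conv
      by (auto simp: x_eq scaleR_sum_right sum_divide_distrib [symmetric])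
    then have "(e + S) *\<^sub>R ((1 / (e + S)) *\<^sub>R x) + (1 - (e + S)) *\<^sub>R 0 \<in> \<Gamma>"
      using zero_in_\<Gamma> S0 S1 e by (intro convexD [OF conv]) auto
    then show "x \<in> \<Gamma>"
      using S0 e by simp
  qed
  then show ?thesis
    using e by (meson centre_in_ball interior_maximal open_ball subsetD)
qed

text \<open>\<open>\<Gamma>\<close> lies in the cube of points with coordinates between -1 and 1, so
  an interior point has all coordinates strictly between them, and an integral one is 0.\<close>

lemma fano_\<Gamma>: "fano_polytope \<Gamma>"
proof -
  have "x = 0" if int: "x \<in> interior \<Gamma>" and lat: "x \<in> int_lattice" for x
  proof -
    have "\<bar>x $ j\<bar> < 1" for j
    proof -
      obtain e where e: "e > 0" "ball x e \<subseteq> \<Gamma>"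
        using int by (meson mem_interior)
      have "x + (e / 2) *\<^sub>R (c *\<^sub>R axis j 1) \<in> \<Gamma>" if "\<bar>c\<bar> = 1" for c
        using e that by (intro subsetD [OF e(2)]) (simp add: dist_norm abs_mult)
      then have "\<bar>x $ j + e / 2 * c\<bar> \<le> 1" if "\<bar>c\<bar> = 1" for c
        using \<Gamma>_nth_le [of _ j] that by fastforce
      from this [of 1] this [of "-1"] show ?thesis
        using e by (auto simp: abs_le_iff abs_less_iff)
    qed
    then show ?thesis
      using lat by (auto simp: vec_eq_iff int_lattice_def intro: Ints_nonzero_abs_less1)
  qed
  moreover have "0 \<in> int_lattice"
    by (simp add: int_lattice_def)
  moreover have "polytope_vertices \<Gamma> \<subseteq> int_lattice"
    using extreme_point_\<Gamma>_cases gens_subset_int_lattice \<open>0 \<in> int_lattice\<close>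
    by (auto simp: polytope_vertices_def)
  ultimately show ?thesis
    using polytope_\<Gamma> zero_in_interior_\<Gamma> by (auto simp: fano_polytope_def)
qed

end

section \<open>Forbidden relations among the vertices of a facet\<close>

text \<open>Greedy construction: always append a remaining element with the fewest elements below
  it. Anything strictly below it has still fewer, so it is already listed, and each initial segment
  is an ideal.\<close>

lemma exists_linear_extension:
  fixes p :: "'n::finite \<Rightarrow> 'a"
  assumes po: "partial_order_on P r" and bij: "bij_betw p UNIV P"
  obtains i :: "nat \<Rightarrow> 'n" where "bij_betw i {1..CARD('n)} UNIV"
    and "\<And>k. k \<le> CARD('n) \<Longrightarrow> poset_ideal P r (p ` i ` {1..k})"
proof -
  have refl: "(x, x) \<in> r" if "x \<in> P" for x
    using po that by (auto simp: partial_order_on_def preorder_on_def refl_on_def)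
  have fin: "finite P" and P: "P = range p"
    using bij by (auto simp: bij_betw_def)
  have antisym: "antisym r" and trans: "trans r"
    using po by (auto simp: partial_order_on_def preorder_on_def)
  define D where "D = (\<lambda>x. {y \<in> P. (y, p x) \<in> r})"
  have less: "card (D z) < card (D x)" if "(p z, p x) \<in> r" "z \<noteq> x" for z x
  proof (rule psubset_card_mono)
    have "p z \<noteq> p x"
      using bij that(2) by (auto simp: bij_betw_def inj_eq)
    then have "p x \<in> D x" "p x \<notin> D z"
      using refl [of "p x"] antisymD [OF antisym that(1), symmetric] that(1) P
      by (auto simp: D_def dest: antisymD [OF antisym])
    moreover have "D z \<subseteq> D x"
      using transD [OF trans _ that(1)] by (auto simp: D_def)
    ultimately show "D z \<subset> D x" by blast
  qed (simp add: D_def fin)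
  have "\<exists>i :: nat \<Rightarrow> 'n. inj_on i {1..m} \<and> (\<forall>k\<le>m. poset_ideal P r (p ` i ` {1..k}))"
    if "m \<le> CARD('n)" for m
    using that
  proof (induction m)
    case 0
    then show ?case by (auto simp: poset_ideal_def)
  next
    case (Suc m)
    then obtain i :: "nat \<Rightarrow> 'n" where inj: "inj_on i {1..m}"
      and ideals: "\<And>k. k \<le> m \<Longrightarrow> poset_ideal P r (p ` i ` {1..k})"
      by auto
    define U where "U = - i ` {1..m}"
    have "card (i ` {1..m}) < CARD('n)"
      using card_image_le [of "{1..m}" i] Suc.prems by simp
    then have "U \<noteq> {}"
      unfolding U_def by (metis Compl_UNIV_eq double_compl less_irrefl)
    then obtain x where x: "x \<in> U" "\<And>z. z \<in> U \<Longrightarrow> card (D x) \<le> card (D z)"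
      using ex_min_if_finite [of "(\<lambda>z. card (D z)) ` U"] by (force simp: not_less)
    define i' where "i' = i(Suc m := x)"
    have same: "i' ` {1..k} = i ` {1..k}" if "k \<le> m" for k
      using that by (intro image_cong) (auto simp: i'_def)
    have Suc_eq: "{1..Suc m} = insert (Suc m) {1..m}" and i'_Suc: "i' (Suc m) = x"
      by (auto simp: i'_def)
    have last: "i' ` {1..Suc m} = insert x (i ` {1..m})"
      unfolding Suc_eq image_insert i'_Suc same [OF order_refl] ..
    have "inj_on i' {1..m}"
      using inj by (rule inj_on_cong [THEN iffD1, rotated]) (simp add: i'_def)
    moreover have "x \<notin> i ` {1..m}"
      using x(1) unfolding U_def by blast
    ultimately have "inj_on i' {1..Suc m}"
      unfolding Suc_eq inj_on_insert i'_Suc using same [OF order_refl] by auto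
    moreover have "poset_ideal P r (p ` i' ` {1..Suc m})"
      unfolding poset_ideal_def
    proof (intro conjI ballI impI)
      fix w y assume w: "w \<in> p ` i' ` {1..Suc m}" and y: "y \<in> P" "(y, w) \<in> r"
      show "y \<in> p ` i' ` {1..Suc m}"
      proof (cases "w = p x")
        case True
        obtain z where z: "y = p z"
          using y(1) unfolding P by blast
        show ?thesis
        proof (cases "z = x")
          case False
          then have "card (D z) < card (D x)"
            using less y(2) unfolding True z by blast
          then have "z \<notin> U"
            using x(2) [of z] by auto
          then have "z \<in> i ` {1..m}"
            unfolding U_def by blast
          then show ?thesis
            unfolding last z by blast
        qed (use z last in auto)
      next
        case False
        then have "w \<in> p ` i ` {1..m}"
          using w unfolding last by blast
        then have "y \<in> p ` i ` {1..m}"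
          using ideals [of m] y unfolding poset_ideal_def by blast
        then show ?thesis
          unfolding last by blast
      qed
    qed (auto simp: P)
    ultimately show ?case
      using same ideals by (intro exI [of _ i']) (auto simp: le_Suc_eq)
  qed
  from this [of "CARD('n)"] obtain i :: "nat \<Rightarrow> 'n" where i: "inj_on i {1..CARD('n)}"
    "\<And>k. k \<le> CARD('n) \<Longrightarrow> poset_ideal P r (p ` i ` {1..k})"
    by auto
  have "i ` {1..CARD('n)} = UNIV"
    using card_image [OF i(1)] by (intro card_subset_eq) auto
  then show thesis
    using that i by (auto simp: bij_betw_def)
qed

lemma axis_one_nth: "axis c (1 :: real) $ j = of_bool (j = c)"
  by (simp add: axis_def)

lemma rho_insert:
  "p x \<notin> S \<Longrightarrow> inj p \<Longrightarrow> rho p (insert (p x) S) = rho p S + axis x 1"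
  by (auto simp: vec_eq_iff axis_def inj_eq)

context labelled_posets
begin

lemma rho_p_eqD:
  assumes "I \<subseteq> P" "J \<subseteq> P" "rho p I = rho p J"
  shows "I = J"
proof -
  have "p j \<in> I \<longleftrightarrow> p j \<in> J" for j
    using arg_cong [OF assms(3), of "\<lambda>v. v $ j"] by (simp add: of_bool_eq_iff)
  then show ?thesis
    using assms(1,2) unfolding P_eq by blast
qed

text \<open>A parallelogram of vertices on a common supporting hyperplane off the origin spoils
  both properties: its relation is an affine dependency and an integral one.\<close>

lemma no_parallelogram:
  assumes QS: "Q_factorial_fano \<Gamma> \<or> smooth_fano \<Gamma>"
    and f: "\<And>v. v \<in> gens \<Longrightarrow> f \<bullet> v \<le> 1"
    and gens: "{v1, v2, v3, v4} \<subseteq> gens"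
    and tight: "\<And>v. v \<in> {v1, v2, v3, v4} \<Longrightarrow> f \<bullet> v = 1"
    and eq: "v1 + v2 = v3 + v4" and neq: "v1 \<notin> {v2, v3, v4}"
  shows False
proof -
  let ?V = "{v1, v2, v3, v4}"
  \<comment> \<open>This exposed face misses the origin, hence is proper and lies in a facet; the
    four points are vertices of that facet.\<close>
  define G where "G = \<Gamma> \<inter> {x. f \<bullet> x = 1}"
  have "G face_of \<Gamma>"
    unfolding G_def
    by (rule face_of_Int_supporting_hyperplane_le) (use \<Gamma>_inner_le [OF f] in \<open>auto simp: \<Gamma>_eq\<close>)
  moreover have VG: "?V \<subseteq> G"
    using gens gens_subset_\<Gamma> tight unfolding G_def by blast
  moreover have "0 \<notin> G"
    by (simp add: G_def)
  then have "G \<noteq> \<Gamma>"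
    using zero_in_\<Gamma> by blast
  ultimately obtain F where F: "F facet_of \<Gamma>" "G \<subseteq> F"
    using face_of_polyhedron_subset_facet [OF polytope_imp_polyhedron [OF polytope_\<Gamma>], of G] by blast
  have V: "?V \<subseteq> polytope_vertices F"
    using gens VG F extreme_gens extreme_point_of_face [OF facet_of_imp_face_of [OF F(1)]]
    unfolding polytope_vertices_def by blast
  show False
    using QS
  proof
    assume "Q_factorial_fano \<Gamma>"
    then obtain n where "n simplex F"
      using F(1) by (auto simp: Q_factorial_fano_def simplicial_polytope_def)
    then obtain C where C: "\<not> affine_dependent C" "F = convex hull C"
      by (auto simp: simplex_def)
    then have "?V \<subseteq> C"
      using V extreme_point_of_convex_hull_affine_independent [OF C(1)] by (auto simp: polytope_vertices_def)
    then have "1 *\<^sub>R v3 + 1 *\<^sub>R v4 + (-1) *\<^sub>R v2 \<in> affine hull (C - {v1})"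
      using neq by (intro mem_affine_3) (auto intro!: hull_inc)
    moreover have "1 *\<^sub>R v3 + 1 *\<^sub>R v4 + (-1) *\<^sub>R v2 = v1"
      using eq by (simp add: algebra_simps)
    ultimately show False
      using C(1) \<open>?V \<subseteq> C\<close> by (auto simp: affine_dependent_def)
  next
    assume "smooth_fano \<Gamma>"
    then have indep: "int_module.independent (polytope_vertices F)"
      using F(1) by (auto simp: smooth_fano_def int_lattice_basis_def)
    \<comment> \<open>Indicators are added up, so coincidences among \<open>v2\<close>,
      \<open>v3\<close> and \<open>v4\<close> need no case split; the value at \<open>v1\<close> is
      1.\<close>
    define u :: "real ^ 'n \<Rightarrow> int" where
      "u = (\<lambda>x. of_bool (x = v1) + of_bool (x = v2) - of_bool (x = v3) - of_bool (x = v4))"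
    have *: "(\<Sum>x\<in>?V. of_int (of_bool (x = w)) *\<^sub>R x) = w" if "w \<in> ?V" for w
    proof -
      have "(\<Sum>x\<in>?V. of_int (of_bool (x = w)) *\<^sub>R x) = (\<Sum>x\<in>?V. if x = w then x else 0)"
        by (intro sum.cong) auto
      also have "\<dots> = w"
        by (subst sum.delta) (use that in auto)
      finally show ?thesis .
    qed
    have "(\<Sum>x\<in>?V. of_int (u x) *\<^sub>R x) = v1 + v2 - v3 - v4"
      unfolding u_def of_int_add of_int_diff scaleR_add_left scaleR_diff_left sum.distrib sum_subtractf
      by (simp only: * insertI1 insertI2)
    also have "\<dots> = 0"
      using eq by simp
    finally have "u v1 = 0"
      by (intro int_module.independentD [OF indep _ V]) auto
    then show False
      using neq by (simp add: u_def)
  qed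
qed

section \<open>Ideals and antichains forced by either property\<close>

text \<open>The relation is modularity of union and intersection. The common point \<open>a\<close>
  keeps the intersection nonempty and puts all four vectors on the hyperplane
  \<open>x $ a = 1\<close>.\<close>

lemma intersecting_ideals_comparable:
  assumes QS: "Q_factorial_fano \<Gamma> \<or> smooth_fano \<Gamma>"
    and I: "poset_ideal P r I" and J: "poset_ideal P r J" and a: "p a \<in> I" "p a \<in> J"
  shows "I \<subseteq> J \<or> J \<subseteq> I"
proof (rule ccontr)
  assume nc: "\<not> (I \<subseteq> J \<or> J \<subseteq> I)"
  have U: "poset_ideal P r (I \<union> J)" and N: "poset_ideal P r (I \<inter> J)"
    using I J unfolding poset_ideal_def by blast+
  have sub: "I \<subseteq> P" "J \<subseteq> P"
    using I J by (auto simp: poset_ideal_def)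
  show False
  proof (rule no_parallelogram [OF QS])
    show "axis a 1 \<bullet> v \<le> 1" if "v \<in> gens" for v
      using \<Gamma>_nth_le [of v a] that gens_subset_\<Gamma> by (auto simp: inner_axis')
    show "{rho p I, rho p J, rho p (I \<union> J), rho p (I \<inter> J)} \<subseteq> gens"
      using gens_rhoI [OF I] gens_rhoI [OF J] gens_rhoI [OF U] gens_rhoI [OF N] a by auto
    show "axis a 1 \<bullet> v = 1" if "v \<in> {rho p I, rho p J, rho p (I \<union> J), rho p (I \<inter> J)}" for v
      using that a by (auto simp: inner_axis')
    show "rho p I + rho p J = rho p (I \<union> J) + rho p (I \<inter> J)"
      by (auto simp: vec_eq_iff)
    have "I \<noteq> J" "I \<noteq> I \<union> J" "I \<noteq> I \<inter> J"
      using nc by auto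
    then show "rho p I \<notin> {rho p J, rho p (I \<union> J), rho p (I \<inter> J)}"
      using rho_p_eqD [of I J] rho_p_eqD [of I "I \<union> J"] rho_p_eqD [of I "I \<inter> J"] sub by auto
  qed
qed

text \<open>As \<open>f\<close> vanishes at coordinate \<open>x\<close>, tightness at
  \<open>K\<close> and at \<open>- axis y 1\<close> carries over to the two vertices that involve
  \<open>x\<close>.\<close>

lemma no_ideal_step:
  assumes QS: "Q_factorial_fano \<Gamma> \<or> smooth_fano \<Gamma>"
    and K: "poset_ideal P r K" "K \<noteq> {}" "p x \<notin> K" and L: "poset_ideal P r (insert (p x) K)"
    and A: "antichain Q s {q x, q y}" "x \<noteq> y"
    and f: "\<And>I. poset_ideal P r I \<Longrightarrow> I \<noteq> {} \<Longrightarrow> f \<bullet> rho p I \<le> 1"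
      "\<And>A. antichain Q s A \<Longrightarrow> A \<noteq> {} \<Longrightarrow> f \<bullet> - rho q A \<le> 1"
    and tight: "f \<bullet> rho p K = 1" "f $ x = 0" "f $ y = -1"
  shows False
proof -
  have L_eq: "rho p (insert (p x) K) = rho p K + axis x 1"
    using rho_insert [OF K(3) inj_p] .
  have A_eq: "- rho q {q x, q y} = - axis x 1 - axis y 1"
    using rho_insert [of q x "{q y}"] A(2) inj_q by (simp add: rho_singleton inj_eq)
  show False
  proof (rule no_parallelogram [OF QS])
    show "f \<bullet> v \<le> 1" if "v \<in> gens" for v
      using that f unfolding gens_def by blast
    show "{rho p (insert (p x) K), - rho q {q x, q y}, rho p K, - axis y 1} \<subseteq> gens"
      using gens_rhoI [OF L] gens_rhoI [OF K(1,2)] gens_minus_rhoI [OF A(1)]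
        gens_minus_rhoI [OF singleton_antichain [of y]]
      by (auto simp: rho_singleton [OF inj_q])
    show "f \<bullet> v = 1" if "v \<in> {rho p (insert (p x) K), - rho q {q x, q y}, rho p K, - axis y 1}" for v
      using that tight by (auto simp: L_eq A_eq inner_add_right inner_diff_right inner_axis)
    show "rho p (insert (p x) K) + - rho q {q x, q y} = rho p K + - axis y 1"
      by (simp add: L_eq A_eq)
    \<comment> \<open>The \<open>x\<close>-coordinates 1, -1, 0, 0 separate the first vertex from
      the others.\<close>
    have "rho p (insert (p x) K) $ x = 1" "(- rho q {q x, q y}) $ x = -1" "rho p K $ x = 0"
      "(- axis y 1 :: real ^ 'n) $ x = 0"
      using K(3) A(2) by (auto simp: axis_def)
    then show "rho p (insert (p x) K) \<notin> {- rho q {q x, q y}, rho p K, - axis y 1}"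
      by (metis (no_types, opaque_lifting) insertE singletonD one_neq_neg_one zero_neq_one)
  qed
qed

text \<open>An ideal containing \<open>p (i 1)\<close> is comparable with the initial segment of its
  own size, hence equal to it. An ideal avoiding \<open>p (i 1)\<close> lies in the initial segment
  ending at any of its members, so it is a singleton; adding \<open>p (i 1)\<close> gives an ideal
  of size two, which forces the index 2.\<close>

lemma ideals_of_simplicial_or_smooth:
  assumes QS: "Q_factorial_fano \<Gamma> \<or> smooth_fano \<Gamma>"
    and i: "bij_betw i {1..CARD('n)} UNIV"
    and ideals: "\<And>k. k \<le> CARD('n) \<Longrightarrow> poset_ideal P r (p ` i ` {1..k})"
    and J: "poset_ideal P r J" "J \<noteq> {}"
  shows "(\<exists>k\<in>{1..CARD('n)}. J = p ` i ` {1..k}) \<or> J = {p (i 2)}"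
proof -
  define I where "I = (\<lambda>k. p ` i ` {1..k})"
  have inj_pi: "inj_on (\<lambda>k. p (i k)) {1..CARD('n)}"
    using comp_inj_on [OF bij_betw_imp_inj_on [OF i] inj_on_subset [OF inj_p]] by (simp add: comp_def)
  have card_I: "card (I k) = k" if "k \<le> CARD('n)" for k
    using card_image [OF inj_on_subset [OF inj_pi, of "{1..k}"]] that by (simp add: I_def image_image)
  have in_I: "p (i m) \<in> I k \<longleftrightarrow> m \<le> k" if "m \<in> {1..CARD('n)}" "k \<le> CARD('n)" for m k
    using inj_on_image_mem_iff [OF inj_pi that(1), of "{1..k}"] that by (auto simp: I_def image_image)
  have ideal_I: "poset_ideal P r (I k)" if "k \<le> CARD('n)" for k
    using ideals that by (simp add: I_def)
  have finJ: "finite J" and cardJ: "card J \<le> CARD('n)"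
    using J(1) card_mono [of P J] card_image [OF inj_p] by (auto simp: poset_ideal_def P_eq intro: finite_subset)
  have comp: "p (i m) \<in> J' \<Longrightarrow> m \<le> k \<Longrightarrow> poset_ideal P r J' \<Longrightarrow> J' \<subseteq> I k \<or> I k \<subseteq> J'"
    if "m \<in> {1..CARD('n)}" "k \<le> CARD('n)" for m k J'
    using intersecting_ideals_comparable [OF QS _ ideal_I, of J' k "i m"] in_I that by auto
  have ex: "J' = I (card J')"
    if J': "poset_ideal P r J'" "p (i 1) \<in> J'" "finite J'" "card J' \<le> CARD('n)" for J'
  proof -
    have "card J' \<ge> 1"
      using J'(2,3) by (auto simp: Suc_le_eq card_gt_0_iff)
    then have "J' \<subseteq> I (card J') \<or> I (card J') \<subseteq> J'"
      using comp [of 1 "card J'" J'] J' by auto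
    then show ?thesis
      using card_I [OF J'(4)] J'(3) by (metis card_subset_eq finite_imageI finite_atLeastAtMost I_def)
  qed
  show ?thesis
  proof (cases "p (i 1) \<in> J")
    case True
    have "card J \<in> {1..CARD('n)}"
      using J(2) finJ cardJ by (simp add: Suc_le_eq card_gt_0_iff)
    moreover have "J = p ` i ` {1..card J}"
      using ex [OF J(1) True finJ cardJ] unfolding I_def .
    ultimately show ?thesis by blast
  next
    case False
    have one_in: "p (i 1) \<in> I k" if "1 \<le> k" "k \<le> CARD('n)" for k
      using that in_I [of 1 k] by auto
    obtain a where "p a \<in> J"
      using nonempty_ideal [OF J] .
    then have "\<exists>m\<in>{1..CARD('n)}. p (i m) \<in> J"
      using i by (metis UNIV_I bij_betw_def imageE)
    then obtain m where m: "m \<in> {1..CARD('n)}" "p (i m) \<in> J"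
      by blast
    have sub: "J \<subseteq> I k" if "n \<in> {1..CARD('n)}" "p (i n) \<in> J" "n \<le> k" "k \<le> CARD('n)" for n k
      using comp [OF that(1,4,2,3) J(1)] one_in [of k] False that by auto
    have J_eq: "J = {p (i m)}"
    proof -
      have "n = m" if n: "n \<in> {1..CARD('n)}" "p (i n) \<in> J" for n
      proof -
        have "p (i m) \<in> I n" "p (i n) \<in> I m"
          using sub [OF n, of n] sub [OF m, of m] m n by auto
        then show ?thesis
          using in_I [OF n(1), of m] in_I [OF m(1), of n] m(1) n(1) by simp
      qed
      moreover have "\<exists>n\<in>{1..CARD('n)}. y = p (i n)" if "y \<in> J" for y
      proof -
        obtain a where "y = p a"
          using \<open>y \<in> J\<close> J(1) unfolding poset_ideal_def P_eq by blast
        then show ?thesis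
          using i by (metis UNIV_I bij_betw_def imageE)
      qed
      ultimately show ?thesis
        using m by blast
    qed
    have m1: "m \<noteq> 1"
      using m(2) False by auto
    define J' where "J' = {p (i m), p (i 1)}"
    have J': "poset_ideal P r J'"
      using J(1) ideal_I [of 1] unfolding J_eq J'_def I_def poset_ideal_def by fastforce
    have "card J' = 2"
      using m1 m(1) inj_onD [OF inj_pi, of m 1] by (auto simp: J'_def card_insert_if)
    then have "J' = I 2"
      using ex [OF J'] card2 by (auto simp: J'_def)
    then have "m \<le> 2"
      using in_I [OF m(1), of 2] card2 by (auto simp: J'_def)
    then show ?thesis
      using m m1 J_eq by (cases "m = 2") auto
  qed
qed

text \<open>Each case feeds \<open>no_ideal_step\<close> with an ideal \<open>K\<close>, a choice of
  which index is added to it, and a functional. Any other pair has \<open>n \<ge> 3\<close>, which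
  keeps \<open>i n\<close> apart from \<open>i 1\<close> and \<open>i 2\<close>.\<close>

lemma antichains_of_simplicial_or_smooth:
  assumes QS: "Q_factorial_fano \<Gamma> \<or> smooth_fano \<Gamma>"
    and i: "bij_betw i {1..CARD('n)} UNIV"
    and ideals: "\<And>k. k \<le> CARD('n) \<Longrightarrow> poset_ideal P r (p ` i ` {1..k})"
    and mn: "1 \<le> m" "m < n" "n \<le> CARD('n)"
    and A: "antichain Q s {q (i m), q (i n)}"
  shows "m = 1 \<and> n = 2"
proof (rule ccontr)
  assume "\<not> (m = 1 \<and> n = 2)"
  then have n3: "n \<ge> 3"
    using mn by auto
  have inj: "i k = i l \<longleftrightarrow> k = l" if "k \<in> {1..CARD('n)}" "l \<in> {1..CARD('n)}" for k l
    using i that by (auto simp: bij_betw_def inj_on_eq_iff)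
  have in_I: "p (i k) \<in> p ` i ` {1..l} \<longleftrightarrow> k \<le> l" if "k \<in> {1..CARD('n)}" "l \<le> CARD('n)" for k l
  proof -
    have "p (i k) \<in> p ` i ` {1..l} \<longleftrightarrow> i k \<in> i ` {1..l}"
      using inj_image_mem_iff [OF inj_p] .
    also have "\<dots> \<longleftrightarrow> k \<le> l"
      using inj [OF that(1)] that by fastforce
    finally show ?thesis .
  qed
  have step: "insert (p (i k)) (p ` i ` {1..k-1}) = p ` i ` {1..k}" if "k \<ge> 1" for k
  proof -
    have "{1..k} = insert k {1..k-1}"
      using that by auto
    then show ?thesis by simp
  qed
  have f_diff: "(axis c 1 - axis b 1) \<bullet> rho p S \<le> 1" "(axis c 1 - axis b 1) \<bullet> - rho q S' \<le> 1"
    for b c :: 'n and S S'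
    by (auto simp: inner_diff_left inner_axis' of_bool_def)
  have ne: "i m \<noteq> i n"
    using inj mn by auto
  consider "m \<ge> 2" | "m = 1" "poset_ideal P r {p (i 2)}" | "m = 1" "\<not> poset_ideal P r {p (i 2)}"
    using mn by linarith
  then show False
  proof cases
    case 1
    \<comment> \<open>\<open>K\<close> stops just before \<open>i m\<close>; since
      \<open>m \<ge> 2\<close>, it contains \<open>i 1\<close>, where \<open>f\<close> is positive,
      but not \<open>i n\<close>.\<close>
    have "p (i 1) \<in> p ` i ` {1..m - 1}"
      using 1 by auto
    moreover have "p (i n) \<notin> p ` i ` {1..m - 1}" "p (i m) \<notin> p ` i ` {1..m - 1}"
      using in_I mn by auto
    moreover have "poset_ideal P r (p ` i ` {1..m - 1})" "poset_ideal P r (insert (p (i m)) (p ` i ` {1..m - 1}))"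
      using ideals mn step by auto
    moreover have "i 1 \<noteq> i m" "i 1 \<noteq> i n"
      using inj mn 1 by auto
    ultimately show False
      using A ne f_diff
      by (intro no_ideal_step [OF QS, of "p ` i ` {1..m - 1}" "i m" "i n" "axis (i 1) 1 - axis (i n) 1"])
         (auto simp: inner_diff_left inner_axis' axis_one_nth)
  next
    case 2
    \<comment> \<open>\<open>K\<close> is \<open>{p (i 2)}\<close>, and \<open>i 1\<close> is added
      to it.\<close>
    have "poset_ideal P r (insert (p (i 1)) {p (i 2)})"
      using ideals [of 2] card2 by (simp add: numeral_2_eq_2 atLeastAtMostSuc_conv insert_commute)
    moreover have "i 1 \<noteq> i 2" "i 1 \<noteq> i n" "i 2 \<noteq> i n"
      using inj mn n3 2 by auto
    ultimately show False
      using 2 A ne f_diff inj_p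
      by (intro no_ideal_step [OF QS, of "{p (i 2)}" "i 1" "i n" "axis (i 2) 1 - axis (i n) 1"])
         (auto simp: inner_diff_left inner_axis' axis_one_nth inj_eq)
  next
    case 3
    \<comment> \<open>Every nonempty ideal now contains \<open>p (i 1)\<close>, so the coefficient
      -1 at \<open>i 1\<close> offsets the 2 at \<open>i 2\<close>. The roles are swapped:
      \<open>i n\<close> is added to the segment before it, and \<open>y = i 1\<close>.\<close>
    let ?f = "2 *\<^sub>R axis (i 2) 1 - axis (i 1) 1 :: real ^ 'n"
    have "?f \<bullet> rho p I \<le> 1" if I: "poset_ideal P r I" "I \<noteq> {}" for I
    proof -
      have "I \<noteq> {p (i 2)}"
        using 3(2) I(1) by auto
      then obtain k where "k \<in> {1..CARD('n)}" "I = p ` i ` {1..k}"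
        using ideals_of_simplicial_or_smooth [OF QS i ideals I] by blast
      then have "p (i 1) \<in> I"
        by auto
      then show ?thesis
        by (auto simp: inner_diff_left inner_axis' of_bool_def)
    qed
    moreover have "?f \<bullet> - rho q S \<le> 1" for S
      by (auto simp: inner_diff_left inner_axis' of_bool_def)
    moreover have "p (i 1) \<in> p ` i ` {1..n - 1}" "p (i 2) \<in> p ` i ` {1..n - 1}"
      using n3 by auto
    moreover have "p (i n) \<notin> p ` i ` {1..n - 1}"
      using in_I [of n "n - 1"] mn by auto
    moreover have "poset_ideal P r (p ` i ` {1..n - 1})" "poset_ideal P r (insert (p (i n)) (p ` i ` {1..n - 1}))"
      using ideals mn step by auto
    moreover have "i 1 \<noteq> i 2" "i 1 \<noteq> i n" "i 2 \<noteq> i n"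
      using inj mn n3 by auto
    ultimately show False
      using 3 A
      by (intro no_ideal_step [OF QS, of "p ` i ` {1..n - 1}" "i n" "i 1" ?f])
         (auto simp: inner_diff_left inner_axis' axis_one_nth insert_commute)
  qed
qed

text \<open>Condition (iii) in the exact wording of the theorem, so that it can be folded
  there.\<close>

definition normal_form :: "(nat \<Rightarrow> 'n) \<Rightarrow> bool" where
  "normal_form i \<longleftrightarrow> bij_betw i {1..CARD('n)} UNIV \<and>
        ({I. poset_ideal P r I \<and> I \<noteq> {}} = {p ` i ` {1..k} | k. k \<in> {1..CARD('n)}} \<or>
         {I. poset_ideal P r I \<and> I \<noteq> {}} =
           {{p (i 1)}, {p (i 2)}} \<union> {p ` i ` {1..k} | k. k \<in> {2..CARD('n)}}) \<and>
        ({A. antichain Q s A \<and> A \<noteq> {}} = {{q (i k)} | k. k \<in> {1..CARD('n)}} \<or>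
         {A. antichain Q s A \<and> A \<noteq> {}} =
           {{q (i k)} | k. k \<in> {1..CARD('n)}} \<union> {{q (i 1), q (i 2)}})"

text \<open>Any linear extension of \<open>P\<close> serves both posets. The alternatives depend on
  whether \<open>{p (i 2)}\<close> is an ideal and whether \<open>{q (i 1), q (i 2)}\<close> is an
  antichain.\<close>

lemma normal_form_of_simplicial_or_smooth:
  assumes QS: "Q_factorial_fano \<Gamma> \<or> smooth_fano \<Gamma>"
  shows "\<exists>i. normal_form i"
proof -
  obtain i :: "nat \<Rightarrow> 'n" where i: "bij_betw i {1..CARD('n)} UNIV"
    and ideals: "\<And>k. k \<le> CARD('n) \<Longrightarrow> poset_ideal P r (p ` i ` {1..k})"
    using exists_linear_extension [OF po_P bij_p] by blast
  let ?chain = "{p ` i ` {1..k} | k. k \<in> {1..CARD('n)}}"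
  have chain: "?chain \<subseteq> {I. poset_ideal P r I \<and> I \<noteq> {}}"
    using ideals by auto
  have chain': "?chain = insert {p (i 1)} {p ` i ` {1..k} | k. k \<in> {2..CARD('n)}}"
  proof -
    have "{1..CARD('n)} = insert 1 {2..CARD('n)}"
      using card2 by auto
    then show ?thesis
      unfolding Setcompr_eq_image by simp
  qed
  have P_form: "{I. poset_ideal P r I \<and> I \<noteq> {}} = ?chain \<or>
         {I. poset_ideal P r I \<and> I \<noteq> {}} =
           {{p (i 1)}, {p (i 2)}} \<union> {p ` i ` {1..k} | k. k \<in> {2..CARD('n)}}"
  proof (cases "poset_ideal P r {p (i 2)}")
    case True
    then have "{I. poset_ideal P r I \<and> I \<noteq> {}} = insert {p (i 2)} ?chain"
      using ideals_of_simplicial_or_smooth [OF QS i ideals] chain by blast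
    then show ?thesis
      unfolding chain' by (intro disjI2) (simp only: insert_commute insert_is_Un [symmetric] Un_insert_left Un_empty_left)
  next
    case False
    have "{I. poset_ideal P r I \<and> I \<noteq> {}} \<subseteq> ?chain"
    proof
      fix J assume "J \<in> {I. poset_ideal P r I \<and> I \<noteq> {}}"
      then show "J \<in> ?chain"
        using ideals_of_simplicial_or_smooth [OF QS i ideals, of J] False by auto
    qed
    then show ?thesis
      using chain by blast
  qed
  let ?sing = "{{q (i k)} | k. k \<in> {1..CARD('n)}}" and ?two = "{q (i 1), q (i 2)}"
  have sing: "?sing \<subseteq> {A. antichain Q s A \<and> A \<noteq> {}}"
    using singleton_antichain by auto
  have Q_cases: "A \<in> ?sing \<or> A = ?two" if A: "antichain Q s A" "A \<noteq> {}" for A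
  proof -
    have ex: "\<exists>k\<in>{1..CARD('n)}. x = q (i k)" if "x \<in> A" for x
    proof -
      obtain a where "x = q a"
        using \<open>x \<in> A\<close> A(1) unfolding antichain_def Q_eq by blast
      then show ?thesis
        using i by (metis UNIV_I bij_betw_def imageE)
    qed
    \<comment> \<open>Subsets of antichains are antichains, so the result on pairs restricts
      antichains of every size.\<close>
    have two: "m = 1 \<and> n = 2" if "m \<in> {1..CARD('n)}" "n \<in> {1..CARD('n)}" "m < n" "q (i m) \<in> A" "q (i n) \<in> A" for m n
    proof -
      have "antichain Q s {q (i m), q (i n)}"
        using A(1) that(4,5) unfolding antichain_def by blast
      then show ?thesis
        using antichains_of_simplicial_or_smooth [OF QS i ideals, of m n] that by auto
    qed
    obtain x where "x \<in> A" using A(2) by blast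
    then obtain m where m: "m \<in> {1..CARD('n)}" "q (i m) \<in> A"
      using ex by blast
    show ?thesis
    proof (cases "A = {q (i m)}")
      case False
      then obtain n where n: "n \<in> {1..CARD('n)}" "q (i n) \<in> A" "n \<noteq> m"
        using ex m by blast
      then have 12: "{m, n} = {1, 2}"
        using two [of m n] two [of n m] m by (cases m n rule: linorder_cases) auto
      then have "?two \<subseteq> A"
        using m n by (auto simp: doubleton_eq_iff)
      moreover have "k \<in> {1, 2}" if "k \<in> {1..CARD('n)}" "q (i k) \<in> A" for k
        using two [of 1 k] that \<open>?two \<subseteq> A\<close> card2 by (cases "k = 1") auto
      then have "A \<subseteq> ?two"
        using ex by blast
      ultimately show ?thesis by blast
    qed (use m in blast)
  qed
  have "{A. antichain Q s A \<and> A \<noteq> {}} = ?sing \<or> {A. antichain Q s A \<and> A \<noteq> {}} = ?sing \<union> {?two}"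
  proof (cases "antichain Q s ?two")
    case True
    then have "{A. antichain Q s A \<and> A \<noteq> {}} = ?sing \<union> {?two}"
      using Q_cases sing by blast
    then show ?thesis ..
  next
    case False
    have "{A. antichain Q s A \<and> A \<noteq> {}} \<subseteq> ?sing"
    proof
      fix J assume "J \<in> {A. antichain Q s A \<and> A \<noteq> {}}"
      then show "J \<in> ?sing"
        using Q_cases [of J] False by auto
    qed
    then show ?thesis
      using sing by blast
  qed
  then have "normal_form i"
    unfolding normal_form_def using i P_form by blast
  then show ?thesis by blast
qed

end

section \<open>Facets in the normal form\<close>

text \<open>A line \<open>f = 1\<close> meets at most two points of the hexagon, and these are not opposite. When it
  meets fewer, \<open>u\<close> and \<open>v\<close> are padded arbitrarily to a basis.\<close>

lemma hexagon_unimodular_pair: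
  fixes f g h :: "real ^ 'n::finite"
  defines "H \<equiv> {g, h, g + h, - g, - h, - (g + h)}"
  obtains u v where "{u, v} \<subseteq> H" "{w \<in> H. f \<bullet> w = 1} \<subseteq> {u, v}"
    "\<And>B. {u, v} \<subseteq> B \<Longrightarrow> {g, h} \<subseteq> int_module.span B"
proof -
  note pairI = that
  define x y where "x = f \<bullet> g" and "y = f \<bullet> h"
  note inner = inner_add_right inner_minus_right x_def [symmetric] y_def [symmetric]
  have sp: "{g, h} \<subseteq> int_module.span B"
    if "{u, v} \<subseteq> B" "g = a *\<^sub>R u + b *\<^sub>R v" "h = c *\<^sub>R u + d *\<^sub>R v"
      and coef: "{a, b, c, d} \<subseteq> {-1, 0, 1}" for u v B and a b c d :: real
  proof -
    have "e *\<^sub>R w \<in> int_module.span B" if "e \<in> {-1, 0, 1}" "w \<in> {u, v}" for e :: real and w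
      using that \<open>{u, v} \<subseteq> B\<close> by (auto simp: int_module.span_base int_module.span_neg int_module.span_zero)
    then show ?thesis
      using that(2,3) coef by (auto intro!: int_module.span_add)
  qed
  \<comment> \<open>The implications run through the hexagon, on which \<open>f\<close> takes the
    values \<open>x\<close>, \<open>y\<close>, \<open>x + y\<close> and their negatives.\<close>
  have gen: thesis if "{u, v} \<subseteq> H"
    "x = 1 \<Longrightarrow> g \<in> {u, v}" "y = 1 \<Longrightarrow> h \<in> {u, v}" "x + y = 1 \<Longrightarrow> g + h \<in> {u, v}"
    "x = -1 \<Longrightarrow> - g \<in> {u, v}" "y = -1 \<Longrightarrow> - h \<in> {u, v}" "x + y = -1 \<Longrightarrow> - (g + h) \<in> {u, v}"
    "g = a *\<^sub>R u + b *\<^sub>R v" "h = c *\<^sub>R u + d *\<^sub>R v" "{a, b, c, d} \<subseteq> {-1, 0, 1}"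
    for u v and a b c d :: real
  proof (rule pairI [OF that(1)])
    show "{w \<in> H. f \<bullet> w = 1} \<subseteq> {u, v}"
    proof
      fix w assume "w \<in> {w \<in> H. f \<bullet> w = 1}"
      then have "w \<in> H" and fw: "f \<bullet> w = 1"
        by auto
      then consider "w = g" | "w = h" | "w = g + h" | "w = - g" | "w = - h" | "w = - (g + h)"
        unfolding H_def by blast
      then show "w \<in> {u, v}"
      proof cases
        case 1 then show ?thesis using that(2) fw by (simp only: inner)
      next
        case 2 then show ?thesis using that(3) fw by (simp only: inner)
      next
        case 3 then show ?thesis using that(4) fw by (simp only: inner)
      next
        case 4 then show ?thesis using that(5) fw by (simp only: inner minus_equation_iff [of x])
      next
        case 5 then show ?thesis using that(6) fw by (simp only: inner minus_equation_iff [of y])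
      next
        case 6 then show ?thesis using that(7) fw by (simp only: inner minus_equation_iff [of "x + y"])
      qed
    qed
  qed (rule sp [OF _ that(8-10)])
  \<comment> \<open>First \<open>g\<close> or \<open>- g\<close> lies on the line, then
    \<open>h\<close> or \<open>- h\<close> without these, then only \<open>g + h\<close> or its
    negative, and finally no vertex.\<close>
  consider "x = 1" "y = 0" | "x = 1" "y = -1" | "x = 1" "y = -2" | "x = 1" "y \<noteq> 0" "y \<noteq> -1" "y \<noteq> -2"
    | "x = -1" "y = 0" | "x = -1" "y = 1" | "x = -1" "y = 2" | "x = -1" "y \<noteq> 0" "y \<noteq> 1" "y \<noteq> 2"
    | "x \<noteq> 1" "x \<noteq> -1" "y = 1" "x = -2" | "x \<noteq> 1" "x \<noteq> -1" "y = 1" "x \<noteq> -2"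
    | "x \<noteq> 1" "x \<noteq> -1" "y = -1" "x = 2" | "x \<noteq> 1" "x \<noteq> -1" "y = -1" "x \<noteq> 2"
    | "x \<noteq> 1" "x \<noteq> -1" "y \<noteq> 1" "y \<noteq> -1" "x + y = 1"
    | "x \<noteq> 1" "x \<noteq> -1" "y \<noteq> 1" "y \<noteq> -1" "x + y = -1"
    | "x \<noteq> 1" "x \<noteq> -1" "y \<noteq> 1" "y \<noteq> -1" "x + y \<noteq> 1" "x + y \<noteq> -1"
    by blast
  then show thesis
  proof cases
    case 1 show ?thesis by (rule gen [of g "g + h" 1 0 "-1" 1]) (use 1 in \<open>auto simp: H_def\<close>)
  next
    case 2 show ?thesis by (rule gen [of g "- h" 1 0 0 "-1"]) (use 2 in \<open>auto simp: H_def\<close>)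
  next
    case 3 show ?thesis by (rule gen [of g "- (g + h)" 1 0 "-1" "-1"]) (use 3 in \<open>auto simp: H_def\<close>)
  next
    case 4 show ?thesis by (rule gen [of g h 1 0 0 1]) (use 4 in \<open>auto simp: H_def\<close>)
  next
    case 5 show ?thesis by (rule gen [of "- g" "- (g + h)" "-1" 0 1 "-1"]) (use 5 in \<open>auto simp: H_def\<close>)
  next
    case 6 show ?thesis by (rule gen [of "- g" h "-1" 0 0 1]) (use 6 in \<open>auto simp: H_def\<close>)
  next
    case 7 show ?thesis by (rule gen [of "- g" "g + h" "-1" 0 1 1]) (use 7 in \<open>auto simp: H_def\<close>)
  next
    case 8 show ?thesis by (rule gen [of "- g" "- h" "-1" 0 0 "-1"]) (use 8 in \<open>auto simp: H_def\<close>)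
  next
    case 9 show ?thesis by (rule gen [of h "- (g + h)" "-1" "-1" 1 0]) (use 9 in \<open>auto simp: H_def\<close>)
  next
    case 10 show ?thesis by (rule gen [of h "g + h" "-1" 1 1 0]) (use 10 in \<open>auto simp: H_def\<close>)
  next
    case 11 show ?thesis by (rule gen [of "- h" "g + h" 1 1 "-1" 0]) (use 11 in \<open>auto simp: H_def\<close>)
  next
    case 12 show ?thesis by (rule gen [of "- h" "- (g + h)" 1 "-1" "-1" 0]) (use 12 in \<open>auto simp: H_def\<close>)
  next
    case 13 show ?thesis by (rule gen [of g "g + h" 1 0 "-1" 1]) (use 13 in \<open>auto simp: H_def\<close>)
  next
    case 14 show ?thesis by (rule gen [of g "- (g + h)" 1 0 "-1" "-1"]) (use 14 in \<open>auto simp: H_def\<close>)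
  next
    case 15 show ?thesis by (rule gen [of g h 1 0 0 1]) (use 15 in \<open>auto simp: H_def\<close>)
  qed
qed

section \<open>From supporting functionals of facets to unimodular bases\<close>

context labelled_posets
begin

text \<open>The origin is interior, so the right-hand side of a facet inequality is positive and can
  be scaled to 1.\<close>

lemma facet_of_\<Gamma>_supporting:
  assumes "F facet_of \<Gamma>"
  obtains f where "\<And>x. x \<in> \<Gamma> \<Longrightarrow> f \<bullet> x \<le> 1" "F = \<Gamma> \<inter> {x. f \<bullet> x = 1}"
proof -
  obtain a b where ab: "a \<noteq> 0" "\<Gamma> \<subseteq> {x. a \<bullet> x \<le> b}" "F = \<Gamma> \<inter> {x. a \<bullet> x = b}"
    using facet_of_polyhedron [OF polytope_imp_polyhedron [OF polytope_\<Gamma>] assms] by blast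
  have "0 \<in> interior {x. a \<bullet> x \<le> b}"
    using zero_in_interior_\<Gamma> interior_mono [OF ab(2)] by blast
  then have "b > 0"
    using ab(1) by (simp add: interior_halfspace_le)
  then show thesis
    using that [of "(1 / b) *\<^sub>R a"] ab(2,3) by (auto simp: field_simps)
qed

lemma facet_vertices:
  assumes F: "F facet_of \<Gamma>"
  shows "F = convex hull (polytope_vertices F)" "aff_dim (polytope_vertices F) = int CARD('n) - 1"
proof -
  have "polytope F"
    using face_of_polytope_polytope [OF polytope_\<Gamma>] facet_of_imp_face_of [OF F] by blast
  then show hull: "F = convex hull (polytope_vertices F)"
    using Krein_Milman_Minkowski [of F] polytope_imp_compact polytope_imp_convex
    by (auto simp: polytope_vertices_def)
  have "aff_dim F = aff_dim \<Gamma> - 1"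
    using F by (simp add: facet_of_def)
  also have "aff_dim \<Gamma> = int CARD('n)"
    using zero_in_interior_\<Gamma> aff_dim_nonempty_interior [of \<Gamma>] by force
  finally show "aff_dim (polytope_vertices F) = int CARD('n) - 1"
    using hull aff_dim_convex_hull by metis
qed

text \<open>A facet has at least \<open>CARD('n)\<close> vertices, so they fill \<open>B\<close>.
  Then \<open>int_lattice_basisI\<close> applies, and affine independence follows from dimension and
  cardinality.\<close>

lemma facet_of_basis:
  assumes F: "F facet_of \<Gamma>" and sub: "polytope_vertices F \<subseteq> B" and fin: "finite B"
    and card: "card B \<le> CARD('n)" and lat: "B \<subseteq> int_lattice"
    and ax: "\<And>j. axis j 1 \<in> int_module.span B"
  shows "int_lattice_basis (polytope_vertices F)" "(int CARD('n) - 1) simplex F"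
proof -
  let ?E = "polytope_vertices F"
  have finE: "finite ?E"
    using sub fin finite_subset by blast
  have "int CARD('n) \<le> int (card ?E)"
    using aff_dim_le_card [OF finE] facet_vertices(2) [OF F] by simp
  then have E: "?E = B" and cardE: "card ?E = CARD('n)"
    using card_seteq [OF fin sub] card card_mono [OF fin sub] by auto
  show "int_lattice_basis ?E"
    unfolding E by (rule int_lattice_basisI [OF fin card lat ax])
  have "\<not> affine_dependent ?E"
    using finE cardE facet_vertices(2) [OF F] by (simp add: affine_independent_iff_card)
  then show "(int CARD('n) - 1) simplex F"
    unfolding simplex_def using cardE facet_vertices(1) [OF F] by auto
qed

text \<open>\<open>facet_of_basis\<close> is applied to a pair from the hexagon in the plane of
  \<open>i 1\<close> and \<open>i 2\<close> together with one vector \<open>x k\<close> for each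
  \<open>k \<ge> 3\<close>.\<close>

lemma facet_of_normal_form:
  assumes nf: "normal_form i" and F: "F facet_of \<Gamma>"
  shows "int_lattice_basis (polytope_vertices F)" "(int CARD('n) - 1) simplex F"
proof -
  have i: "bij_betw i {1..CARD('n)} UNIV"
    and P_form: "{I. poset_ideal P r I \<and> I \<noteq> {}} = {p ` i ` {1..k} | k. k \<in> {1..CARD('n)}} \<or>
         {I. poset_ideal P r I \<and> I \<noteq> {}} =
           {{p (i 1)}, {p (i 2)}} \<union> {p ` i ` {1..k} | k. k \<in> {2..CARD('n)}}"
    and Q_form: "{A. antichain Q s A \<and> A \<noteq> {}} = {{q (i k)} | k. k \<in> {1..CARD('n)}} \<or>
         {A. antichain Q s A \<and> A \<noteq> {}} =
           {{q (i k)} | k. k \<in> {1..CARD('n)}} \<union> {{q (i 1), q (i 2)}}"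
    using nf unfolding normal_form_def by blast+
  \<comment> \<open>These rules extract what holds under both alternatives, so the four combinations
    need no separate treatment.\<close>
  have eq_cases: "S = X \<or> S = Y \<Longrightarrow> z \<in> S \<Longrightarrow> z \<in> X \<or> z \<in> Y"
    "S = X \<or> S = Y \<Longrightarrow> z \<in> X \<Longrightarrow> z \<in> Y \<Longrightarrow> z \<in> S" for S X Y :: "'c set" and z
    by auto
  \<comment> \<open>\<open>c k\<close> belongs to the \<open>k\<close>-th initial segment;
    \<open>c 1\<close> and \<open>c 2\<close> fall into the hexagon \<open>H\<close>.\<close>
  define c :: "nat \<Rightarrow> real ^ 'n" where "c = (\<lambda>k. \<Sum>j\<in>{1..k}. axis (i j) 1)"
  define e :: "nat \<Rightarrow> real ^ 'n" where "e = (\<lambda>k. axis (i k) 1)"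
  define H where "H = {e 1, e 2, e 1 + e 2, - e 1, - e 2, - (e 1 + e 2)}"
  have rho_c: "rho p (p ` i ` {1..k}) = c k" if "k \<le> CARD('n)" for k
    using that rho_image [OF inj_p, of "i ` {1..k}"] bij_betw_imp_inj_on [OF i]
    by (simp add: c_def sum.reindex inj_on_subset)
  have c_Suc: "c k = c (k - 1) + e k" if "k \<ge> 1" for k
  proof -
    have "{1..k} = insert k {1..k - 1}"
      using that by auto
    then show ?thesis
      using that by (simp add: c_def e_def)
  qed
  have c12: "c 1 = e 1" "c 2 = e 1 + e 2"
    using c_Suc [of 1] c_Suc [of 2] by (simp_all add: c_def)
  have I_form: "(\<exists>k\<in>{1..CARD('n)}. I = p ` i ` {1..k}) \<or> I = {p (i 2)}"
    if "poset_ideal P r I" "I \<noteq> {}" for I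
  proof -
    have "{p (i 1)} = p ` i ` {1..1}" "1 \<in> {1..CARD('n)}"
      using card2 by auto
    moreover have "{2..CARD('n)} \<subseteq> {1..CARD('n)}" by auto
    moreover have "I \<in> {I. poset_ideal P r I \<and> I \<noteq> {}}" using that by simp
    from eq_cases(1) [OF P_form this] have "I \<in> {p ` i ` {1..k} | k. k \<in> {1..CARD('n)}} \<or>
        I \<in> {{p (i 1)}, {p (i 2)}} \<union> {p ` i ` {1..k} | k. k \<in> {2..CARD('n)}}" .
    ultimately show ?thesis by blast
  qed
  have A_form: "(\<exists>k\<in>{1..CARD('n)}. A = {q (i k)}) \<or> A = {q (i 1), q (i 2)}"
    if "antichain Q s A" "A \<noteq> {}" for A
  proof -
    have "A \<in> {A. antichain Q s A \<and> A \<noteq> {}}" using that by simp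
    from eq_cases(1) [OF Q_form this] have "A \<in> {{q (i k)} | k. k \<in> {1..CARD('n)}} \<or>
        A \<in> {{q (i k)} | k. k \<in> {1..CARD('n)}} \<union> {{q (i 1), q (i 2)}}" .
    then show ?thesis by blast
  qed
  have i12: "i 1 \<noteq> i 2"
    using inj_on_eq_iff [OF bij_betw_imp_inj_on [OF i], of 1 2] card2 by simp
  have gens_form: "(\<exists>k\<in>{3..CARD('n)}. w = c k \<or> w = - e k) \<or> w \<in> H" if "w \<in> gens" for w
  proof -
    have small: "k = 1 \<or> k = 2 \<or> k \<in> {3..CARD('n)}" if "k \<in> {1..CARD('n)}" for k
      using that by auto
    consider I where "w = rho p I" "poset_ideal P r I" "I \<noteq> {}"
      | A where "w = - rho q A" "antichain Q s A" "A \<noteq> {}"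
      using \<open>w \<in> gens\<close> unfolding gens_def by blast
    then show ?thesis
    proof cases
      case 1
      from I_form [OF 1(2,3)] show ?thesis
      proof
        assume "\<exists>k\<in>{1..CARD('n)}. I = p ` i ` {1..k}"
        then obtain k where k: "k \<in> {1..CARD('n)}" "w = c k"
          using 1(1) rho_c by auto
        then show ?thesis
          using small [OF k(1)] c12 unfolding H_def by blast
      next
        assume "I = {p (i 2)}"
        then show ?thesis
          using 1(1) by (simp add: rho_singleton [OF inj_p] H_def e_def)
      qed
    next
      case 2
      from A_form [OF 2(2,3)] show ?thesis
      proof
        assume "\<exists>k\<in>{1..CARD('n)}. A = {q (i k)}"
        then obtain k where k: "k \<in> {1..CARD('n)}" "w = - e k"
          using 2(1) by (auto simp: rho_singleton [OF inj_q] e_def)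
        then show ?thesis
          using small [OF k(1)] unfolding H_def by blast
      next
        assume "A = {q (i 1), q (i 2)}"
        then have "w = - (e 1 + e 2)"
          using 2(1) rho_insert [of q "i 1" "{q (i 2)}"] inj_q i12
          by (simp add: rho_singleton inj_eq e_def)
        then show ?thesis
          unfolding H_def by blast
      qed
    qed
  qed
  have c_gens: "c k \<in> gens" if "k \<in> {2..CARD('n)}" for k
  proof -
    have "p ` i ` {1..k} \<in> {I. poset_ideal P r I \<and> I \<noteq> {}}"
    proof -
      have "k \<in> {1..CARD('n)}" using that by simp
      then have "p ` i ` {1..k} \<in> {p ` i ` {1..k} | k. k \<in> {1..CARD('n)}}"
        "p ` i ` {1..k} \<in> {{p (i 1)}, {p (i 2)}} \<union> {p ` i ` {1..k} | k. k \<in> {2..CARD('n)}}"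
        using that by blast+
      then show ?thesis
        by (rule eq_cases(2) [OF P_form])
    qed
    then show ?thesis
      using gens_rhoI [of "p ` i ` {1..k}"] rho_c [of k] that by simp
  qed
  obtain f where f: "\<And>x. x \<in> \<Gamma> \<Longrightarrow> f \<bullet> x \<le> 1" "F = \<Gamma> \<inter> {x. f \<bullet> x = 1}"
    using facet_of_\<Gamma>_supporting [OF F] by blast
  obtain u v where uv: "{u, v} \<subseteq> H" "{w \<in> H. f \<bullet> w = 1} \<subseteq> {u, v}"
    "\<And>B. {u, v} \<subseteq> B \<Longrightarrow> {e 1, e 2} \<subseteq> int_module.span B"
    by (rule hexagon_unimodular_pair [of "e 1" "e 2" f, folded H_def]) blast
  \<comment> \<open>If neither \<open>c k\<close> nor \<open>- e k\<close> lies on the facet, the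
    default \<open>- e k\<close> pads the system.\<close>
  define x where "x = (\<lambda>k. if f \<bullet> c k = 1 then c k else - e k)"
  define B where "B = {u, v} \<union> x ` {3..CARD('n)}"
  have sub: "polytope_vertices F \<subseteq> B"
  proof
    fix w assume "w \<in> polytope_vertices F"
    then have "w extreme_point_of \<Gamma>" and fw: "f \<bullet> w = 1"
      using extreme_point_of_face [OF facet_of_imp_face_of [OF F]] f(2)
      by (auto simp: polytope_vertices_def)
    \<comment> \<open>The origin is excluded by \<open>f \<bullet> w = 1\<close>.\<close>
    then have "w \<in> gens"
      using extreme_point_\<Gamma>_cases by fastforce
    from gens_form [OF this] show "w \<in> B"
    proof
      assume "\<exists>k\<in>{3..CARD('n)}. w = c k \<or> w = - e k"
      then obtain k where k: "k \<in> {3..CARD('n)}" "w = c k \<or> w = - e k" by blast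
      \<comment> \<open>Otherwise \<open>f\<close> would take the value 2 at
        \<open>c (k - 1) = c k + (- e k)\<close>, a point of \<open>\<Gamma>\<close>.\<close>
      have "f \<bullet> c k \<noteq> 1" if "w = - e k"
      proof
        assume "f \<bullet> c k = 1"
        then have "f \<bullet> c (k - 1) = 2"
          using c_Suc [of k] k(1) fw that by (simp add: inner_add_right)
        moreover have "k - 1 \<in> {2..CARD('n)}"
          using k(1) by auto
        then have "c (k - 1) \<in> \<Gamma>"
          using c_gens gens_subset_\<Gamma> by blast
        ultimately show False
          using f(1) [of "c (k - 1)"] by simp
      qed
      then have "w = x k"
        using k(2) fw by (auto simp: x_def)
      then show ?thesis
        using k(1) by (simp add: B_def)
    qed (use uv(2) fw in \<open>auto simp: B_def\<close>)
  qed
  have lat_e: "e k \<in> int_lattice" for k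
    by (simp add: e_def int_lattice_def axis_one_nth)
  have lat_c: "c k \<in> int_lattice" for k
    unfolding c_def by (rule int_module.subspace_sum [OF subspace_int_lattice]) (rule lat_e [unfolded e_def])
  have "H \<subseteq> int_lattice"
    unfolding H_def using lat_e
    by (auto intro!: int_module.subspace_add [OF subspace_int_lattice] int_module.subspace_neg [OF subspace_int_lattice]
        int_module.subspace_diff [OF subspace_int_lattice])
  then have lat: "B \<subseteq> int_lattice"
    using uv(1) lat_c lat_e int_module.subspace_neg [OF subspace_int_lattice] by (auto simp: B_def x_def)
  have fin: "finite B"
    by (simp add: B_def)
  have "card B \<le> card {u, v} + card (x ` {3..CARD('n)})"
    unfolding B_def by (rule card_Un_le)
  \<comment> \<open>The subtraction on naturals is exact because
    \<open>CARD('n) \<ge> 2\<close>.\<close>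
  also have "\<dots> \<le> 2 + (CARD('n) - 2)"
    using card_image_le [of "{3..CARD('n)}" x] by (intro add_mono) (auto simp: card_insert_if)
  finally have card: "card B \<le> CARD('n)"
    using card2 by simp
  \<comment> \<open>The system is triangular: \<open>x k\<close> is \<open>c (k - 1) + e k\<close>
    or \<open>- e k\<close>, and \<open>c (k - 1)\<close> involves only smaller indices. The hexagon
    pair starts the induction.\<close>
  have e_span: "e k \<in> int_module.span B" if "k \<in> {1..CARD('n)}" for k
    using that
  proof (induction k rule: less_induct)
    case (less k)
    show ?case
    proof (cases "k \<le> 2")
      case True
      then have "k = 1 \<or> k = 2"
        using less.prems by auto
      then show ?thesis
        using uv(3) [of B] by (auto simp: B_def)
    next
      case False
      then have "x k \<in> B"
        using less.prems by (simp add: B_def)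
      then have xk: "x k \<in> int_module.span B"
        by (rule int_module.span_base)
      have "c (k - 1) \<in> int_module.span B"
        unfolding c_def
      proof (rule int_module.span_sum)
        fix j assume "j \<in> {1..k - 1}"
        then have "j < k" "j \<in> {1..CARD('n)}"
          using less.prems by auto
        then show "axis (i j) 1 \<in> int_module.span B"
          using less.IH [of j] unfolding e_def by simp
      qed
      then have "x k - c (k - 1) \<in> int_module.span B"
        by (rule int_module.span_diff [OF xk])
      moreover have "- x k \<in> int_module.span B"
        using xk by (rule int_module.span_neg)
      ultimately show ?thesis
        using c_Suc [of k] False by (cases "f \<bullet> c k = 1") (simp_all add: x_def)
    qed
  qed
  have ax: "axis j 1 \<in> int_module.span B" for j
  proof -
    obtain k where "k \<in> {1..CARD('n)}" "j = i k"
      using i by (metis UNIV_I bij_betw_def imageE)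
    then show ?thesis
      using e_span by (simp add: e_def)
  qed
  show "int_lattice_basis (polytope_vertices F)" "(int CARD('n) - 1) simplex F"
    using facet_of_basis [OF F sub fin card lat ax] by auto
qed

lemma normal_form_imp:
  assumes "normal_form i"
  shows "Q_factorial_fano \<Gamma>" "smooth_fano \<Gamma>"
  using facet_of_normal_form [OF assms] fano_\<Gamma> polytope_\<Gamma>
  by (auto simp: Q_factorial_fano_def smooth_fano_def simplicial_polytope_def)

end

theorem theorem2p2:
  fixes P :: "'a set" and r :: "('a \<times> 'a) set" and p :: "'n::finite \<Rightarrow> 'a"
    and Q :: "'b set" and s :: "('b \<times> 'b) set" and q :: "'n \<Rightarrow> 'b"
  assumes "CARD('n) \<ge> 2"
    and "partial_order_on P r" and "bij_betw p UNIV P"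
    and "partial_order_on Q s" and "bij_betw q UNIV Q"
  shows "(Q_factorial_fano (Gamma_OC P r p Q s q) \<longleftrightarrow> smooth_fano (Gamma_OC P r p Q s q)) \<and>
    (smooth_fano (Gamma_OC P r p Q s q) \<longleftrightarrow>
      (\<exists>i :: nat \<Rightarrow> 'n. bij_betw i {1..CARD('n)} UNIV \<and>
        ({I. poset_ideal P r I \<and> I \<noteq> {}} = {p ` i ` {1..k} | k. k \<in> {1..CARD('n)}} \<or>
         {I. poset_ideal P r I \<and> I \<noteq> {}} =
           {{p (i 1)}, {p (i 2)}} \<union> {p ` i ` {1..k} | k. k \<in> {2..CARD('n)}}) \<and>
        ({A. antichain Q s A \<and> A \<noteq> {}} = {{q (i k)} | k. k \<in> {1..CARD('n)}} \<or>
         {A. antichain Q s A \<and> A \<noteq> {}} =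
           {{q (i k)} | k. k \<in> {1..CARD('n)}} \<union> {{q (i 1), q (i 2)}})))"
proof -
  interpret labelled_posets P r p Q s q
    by unfold_locales (rule assms)+
  show ?thesis
    unfolding \<Gamma>_def [symmetric] normal_form_def [symmetric]
    using normal_form_of_simplicial_or_smooth normal_form_imp by blast
qed

end
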